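(* Let $\kappa$ be an infinite cardinal and let $\mathbb A$ be a collection of hypergraphs such that (a) if $\mathcal A\in\mathbb A$ and $\mathcal B\ll\mathcal A$, then $\mathcal B\in\mathbb A$; (b) if $\mathcal A\in\mathbb A$ and $|\bigcup\mathcal A|>\kappa$, then $\mathcal A$ has a good cut. Then: (1) if every $\mathcal A\in\mathbb A$ with $|\bigcup\mathcal A|\le\kappa$ has a minimal vertex cover, then every $\mathcal A\in\mathbb A$ has a minimal vertex cover; (2) if every $\mathcal A\in\mathbb A$ with $|\bigcup\mathcal A|\le\kappa$ has a maximizing well-ordering, then every $\mathcal A\in\mathbb A$ has a maximizing well-ordering.
   Context: A hypergraph is identified with a family of non-empty sets (its edges); its vertex set is the union of its edges. A vertex cover of $\mathcal A$ is $Y\subseteq\bigcup\mathcal A$ meeting every edge; it is minimal if no proper subset is a vertex cover. A maximizing well-ordering of $\mathcal A$ is a well-ordering of $\bigcup\mathcal A$ in which every edge has a maximal element. For hypergraphs $\mathcal A,\mathcal B$, $\mathcal B\ll\mathcal A$ ($\mathcal B$ is a shrink of $\mathcal A$) iff for every $B\in\mathcal B$ there is $A\in\mathcal A$ with $B\subseteq A$ and $|A\setminus B|<|A|$. If $\mathcal A$ is a hypergraph and $\lambda=|\bigcup\mathcal A|$, a good cut of $\mathcal A$ is an increasing, continuous sequence $\langle G_\alpha:\alpha<\mathrm{cf}(\lambda)\rangle$ of subsets of $\bigcup\mathcal A$, each of cardinality $<\lambda$, such that $G_0=\emptyset$, $\bigcup_{\alpha<\mathrm{cf}(\lambda)}G_\alpha=\bigcup\mathcal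 A$, and for every $A\in\mathcal A$ there is $\alpha<\mathrm{cf}(\lambda)$ with $A\subseteq G_{\alpha+1}$ and $|G_\alpha\cap A|<|A|$. *)

theory Defs
  imports Main
begin

unbundle cardinal_syntax

text \<open>
  Hypergraphs are families of type \<open>'a set set\<close>; the vertex set of \<open>A\<close> is \<open>\<Union>A\<close>.
  Cardinalities are compared with the order-relation based cardinals of HOL, where
  \<open>|X|\<close> is a well-ordering of \<open>X\<close> of least possible order type.
\<close>

definition hypergraph :: "'a set set \<Rightarrow> bool" where
  "hypergraph A \<longleftrightarrow> {} \<notin> A"

definition vertex_cover :: "'a set set \<Rightarrow> 'a set \<Rightarrow> bool" where
  "vertex_cover A Y \<longleftrightarrow> Y \<subseteq> \<Union>A \<and> (\<forall>E\<in>A. Y \<inter> E \<noteq> {})"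

definition minimal_vertex_cover :: "'a set set \<Rightarrow> 'a set \<Rightarrow> bool" where
  "minimal_vertex_cover A Y \<longleftrightarrow> vertex_cover A Y \<and> (\<forall>Z. Z \<subset> Y \<longrightarrow> \<not> vertex_cover A Z)"

definition maximizing_well_ordering :: "'a set set \<Rightarrow> 'a rel \<Rightarrow> bool" where
  "maximizing_well_ordering A r \<longleftrightarrow>
     well_order_on (\<Union>A) r \<and> (\<forall>E\<in>A. \<exists>m\<in>E. \<forall>x\<in>E. (x, m) \<in> r)"

definition shrink :: "'a set set \<Rightarrow> 'a set set \<Rightarrow> bool" (infix \<open>\<lless>\<close> 50) where
  "B \<lless> A \<longleftrightarrow> (\<forall>F\<in>B. \<exists>E\<in>A. F \<subseteq> E \<and> |E - F| <o |E| )"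

text \<open>
  The non-strict version of cofinality is used here, unlike in \<^const>\<open>cofinal\<close>, which no
  subset satisfies if the order has a greatest element. For an infinite cardinal both agree.
\<close>

definition cofinal_subset :: "'a set \<Rightarrow> 'a rel \<Rightarrow> bool" where
  "cofinal_subset K r \<longleftrightarrow> K \<subseteq> Field r \<and> (\<forall>a\<in>Field r. \<exists>b\<in>K. (a, b) \<in> r)"

text \<open>
  The cofinality, as an initial ordinal: a well-ordering \<open>|K|\<close> for a cofinal \<open>K\<close> of least
  cardinality. It is determined only up to order isomorphism, and only the isomorphism type
  matters below.
\<close>

definition cf :: "'a rel \<Rightarrow> 'a rel" where
  "cf r = (SOME s. \<exists>K. cofinal_subset K r \<and> s = |K| \<and>
                        (\<forall>L. cofinal_subset L r \<longrightarrow> |K| \<le>o |L| ))"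

lemma cf_least:
  assumes "Well_order r"
  shows "\<exists>K. cofinal_subset K r \<and> cf r = |K| \<and> (\<forall>L. cofinal_subset L r \<longrightarrow> |K| \<le>o |L| )"
proof -
  let ?R = "card_of ` {K. cofinal_subset K r}"
  have "cofinal_subset (Field r) r"
    using assms by (auto simp: cofinal_subset_def order_on_defs refl_on_def)
  then have "?R \<noteq> {}" by blast
  moreover have "\<forall>s\<in>?R. Card_order s" by (auto simp: card_of_Card_order)
  ultimately obtain s where "s \<in> ?R" "\<forall>t\<in>?R. s \<le>o t"
    using exists_minim_Card_order by metis
  then have "\<exists>s K. cofinal_subset K r \<and> s = |K| \<and> (\<forall>L. cofinal_subset L r \<longrightarrow> |K| \<le>o |L| )"
    by blast
  then show ?thesis unfolding cf_def by (rule someI_ex)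
qed

definition limit_index :: "'i rel \<Rightarrow> 'i \<Rightarrow> bool" where
  "limit_index s d \<longleftrightarrow> d \<in> Field s \<and> underS s d \<noteq> {} \<and>
     (\<forall>a\<in>underS s d. \<exists>b\<in>underS s d. a \<noteq> b \<and> (a, b) \<in> s)"

text \<open>
  A sequence of length \<open>cf \<lambda>\<close> is a function on the field of the well-order \<^term>\<open>cf l\<close>.
  The index \<open>\<alpha> + 1\<close> is \<^term>\<open>wo_rel.suc s {a}\<close>, which is meaningful only if \<open>a\<close> is not the
  greatest index; for infinite \<open>\<lambda>\<close> there is no greatest index.
  ``Increasing'' is understood non-strictly.
\<close>

definition good_cut :: "'a set set \<Rightarrow> ('a \<Rightarrow> 'a set) \<Rightarrow> bool" where
  "good_cut A G \<longleftrightarrow>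
     (let s = cf |\<Union>A| in
       relChain s G \<and>
       (\<forall>d. limit_index s d \<longrightarrow> G d = (\<Union>a\<in>underS s d. G a)) \<and>
       (\<forall>a\<in>Field s. G a \<subseteq> \<Union>A \<and> |G a| <o |\<Union>A| ) \<and>
       (\<forall>a\<in>Field s. underS s a = {} \<longrightarrow> G a = {}) \<and>
       (\<Union>a\<in>Field s. G a) = \<Union>A \<and>
       (\<forall>E\<in>A. \<exists>a\<in>Field s. aboveS s a \<noteq> {} \<and>
          E \<subseteq> G (wo_rel.suc s {a}) \<and> |G a \<inter> E| <o |E| ))"

end

theory Submission
  imports Defs
begin

text \<open>
  A good cut splits the vertex set into the differences of its consecutive members, and the
  intersection of every edge with the last difference it meets is all but fewer than \<open>|E|\<close> of the edge \<open>E\<close>. These top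
  parts therefore form shrinks with smaller vertex sets, to which induction on the number of
  vertices applies. A maximizing well-ordering arises by concatenating those of the top parts; a
  minimal vertex cover arises by going up through the differences, covering at each one minimally
  the top parts of the edges that are not yet met.
\<close>

section \<open>Ordinal sums of well-orderings\<close>

text \<open>This is the ordinal sum of the orders \<open>W i\<close> along \<open>s\<close>. The
  summands are given as the fibres of \<open>\<rho>\<close> in \<open>V\<close>, so that the sum
  stays on the original vertices and needs no tagged disjoint union.\<close>

definition lex_sum :: "'i rel \<Rightarrow> ('a \<Rightarrow> 'i) \<Rightarrow> ('i \<Rightarrow> 'a rel) \<Rightarrow> 'a set \<Rightarrow> 'a rel" where
  "lex_sum s \<rho> W V = {(x, y) \<in> V \<times> V. (\<rho> x, \<rho> y) \<in> s \<and> (\<rho> x = \<rho> y \<longrightarrow> (x, y) \<in> W (\<rho> x))}"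

lemma well_order_on_lex_sum:
  fixes V :: "'a set"
  assumes s: "well_order_on I s" and \<rho>: "\<rho> ` V \<subseteq> I"
    and W: "\<And>i. i \<in> I \<Longrightarrow> well_order_on (V \<inter> \<rho> -` {i}) (W i)"
  shows "well_order_on V (lex_sum s \<rho> W V)"
proof -
  let ?r = "lex_sum s \<rho> W V"
  have reflW: "(x, x) \<in> W (\<rho> x)" if "x \<in> V" for x
    using W[of "\<rho> x"] that \<rho> by (auto simp: order_on_defs refl_on_def)
  have totW: "(x, y) \<in> W (\<rho> x) \<or> (y, x) \<in> W (\<rho> x)" if "x \<in> V" "y \<in> V" "\<rho> x = \<rho> y" for x y
  proof (cases "x = y")
    case False
    moreover have "total_on (V \<inter> \<rho> -` {\<rho> x}) (W (\<rho> x))"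
      using W[of "\<rho> x"] that \<rho> by (auto simp: order_on_defs)
    ultimately show ?thesis using that by (simp add: total_on_def)
  qed (use reflW that in simp)
  have transW: "(x, z) \<in> W (\<rho> x)" if "x \<in> V" "(x, y) \<in> W (\<rho> x)" "(y, z) \<in> W (\<rho> x)" for x y z
    using W[of "\<rho> x"] that \<rho> unfolding order_on_defs by (meson image_subset_iff transD)
  have antW: "x = y" if "x \<in> V" "(x, y) \<in> W (\<rho> x)" "(y, x) \<in> W (\<rho> x)" for x y
    using W[of "\<rho> x"] that \<rho> unfolding order_on_defs by (meson image_subset_iff antisymD)
  have refls: "(i, i) \<in> s" if "i \<in> I" for i
    using s that by (auto simp: order_on_defs refl_on_def)
  have tots: "(i, j) \<in> s \<or> (j, i) \<in> s" if "i \<in> I" "j \<in> I" for i j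
    using s that refls[of i] by (auto simp: order_on_defs total_on_def)
  have transs: "trans s" and ants: "antisym s" and wfs: "wf (s - Id)"
    using s by (auto simp: order_on_defs)
  have "?r \<subseteq> V \<times> V" by (auto simp: lex_sum_def)
  moreover have "refl_on V ?r"
    using reflW refls \<rho> by (auto simp: refl_on_def lex_sum_def)
  moreover have "trans ?r"
  proof (rule transI)
    fix x y z assume xy: "(x, y) \<in> ?r" and yz: "(y, z) \<in> ?r"
    then have V: "x \<in> V" "z \<in> V" and s': "(\<rho> x, \<rho> y) \<in> s" "(\<rho> y, \<rho> z) \<in> s"
      and W': "\<rho> x = \<rho> y \<Longrightarrow> (x, y) \<in> W (\<rho> x)" "\<rho> y = \<rho> z \<Longrightarrow> (y, z) \<in> W (\<rho> y)"
      by (simp_all add: lex_sum_def)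
    have "(\<rho> x, \<rho> z) \<in> s" using transs s' by (rule transD)
    moreover have "(x, z) \<in> W (\<rho> x)" if "\<rho> x = \<rho> z"
    proof -
      \<comment> \<open>The rank of \<open>y\<close> lies between those of \<open>x\<close> and
        \<open>z\<close>, so all three points are in one block and transitivity of that block
        applies.\<close>
      have "\<rho> x = \<rho> y" using antisymD[OF ants] s' that by simp
      then show ?thesis using transW[OF V(1)] W' that by simp
    qed
    ultimately show "(x, z) \<in> ?r" using V by (simp add: lex_sum_def)
  qed
  moreover have "antisym ?r"
  proof (rule antisymI)
    fix x y assume xy: "(x, y) \<in> ?r" and yx: "(y, x) \<in> ?r"
    then have "\<rho> x = \<rho> y" using antisymD[OF ants] by (simp add: lex_sum_def)
    then show "x = y" using xy yx antW[of x y] by (simp add: lex_sum_def)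
  qed
  moreover have "total_on V ?r"
  proof (rule total_onI)
    fix x y assume "x \<in> V" "y \<in> V"
    moreover then have "\<rho> x \<in> I" "\<rho> y \<in> I" using \<rho> by auto
    ultimately show "(x, y) \<in> ?r \<or> (y, x) \<in> ?r"
      using tots[of "\<rho> x" "\<rho> y"] totW[of x y] refls[of "\<rho> x"]
      by (cases "\<rho> x = \<rho> y") (auto simp: lex_sum_def)
  qed
  moreover have "wf (?r - Id)"
    unfolding wf_eq_minimal
  proof (intro allI impI)
    fix Q and q :: 'a assume "q \<in> Q"
    show "\<exists>z\<in>Q. \<forall>y. (y, z) \<in> ?r - Id \<longrightarrow> y \<notin> Q"
    proof (cases "Q \<inter> V = {}")
      case True
      then show ?thesis using \<open>q \<in> Q\<close> by (auto simp: lex_sum_def)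
    next
      case False
      \<comment> \<open>Minimise in two stages: first take the least rank that occurs in
        \<open>Q\<close>, then the least element of \<open>Q\<close> within that block.\<close>
      then obtain i where i: "i \<in> \<rho> ` (Q \<inter> V)"
        and imin: "\<And>j. (j, i) \<in> s - Id \<Longrightarrow> j \<notin> \<rho> ` (Q \<inter> V)"
        using wfE_min[OF wfs, of _ "\<rho> ` (Q \<inter> V)"] by (metis all_not_in_conv image_is_empty)
      have "wf (W i - Id)" using W[of i] i \<rho> by (auto simp: order_on_defs)
      moreover obtain x where "x \<in> Q \<inter> V \<inter> \<rho> -` {i}" using i by auto
      ultimately obtain z where z: "z \<in> Q \<inter> V \<inter> \<rho> -` {i}"
        and zmin: "\<And>y. (y, z) \<in> W i - Id \<Longrightarrow> y \<notin> Q \<inter> V \<inter> \<rho> -` {i}"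
        by (metis wfE_min)
      have "y \<notin> Q" if "(y, z) \<in> ?r - Id" for y
        using that z zmin[of y] imin[of "\<rho> y"] by (auto simp: lex_sum_def)
      then show ?thesis using z by auto
    qed
  qed
  ultimately show ?thesis by (auto simp: order_on_defs)
qed

text \<open>Place the points of \<open>V - U\<close>, arbitrarily well-ordered, above those of
  \<open>U\<close>. The order on \<open>U\<close> is kept, so a maximal element of a subset of
  \<open>U\<close> stays one.\<close>

lemma well_order_on_extension:
  assumes "well_order_on U r" "U \<subseteq> V"
  obtains r' where "well_order_on V r'" "r \<subseteq> r'"
proof -
  obtain q where q: "well_order_on (V - U) q" using well_order_on by blast
  \<comment> \<open>The index order is \<open>False < True\<close>, and \<open>?\<rho>\<close> sends
    \<open>U\<close> to \<open>False\<close>, so the block \<open>U\<close> comes first.\<close>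
  let ?s = "{(b, c). b \<le> c} :: bool rel" and ?\<rho> = "\<lambda>x. x \<notin> U"
  let ?r' = "lex_sum ?s ?\<rho> (\<lambda>b. if b then q else r) V"
  have s: "well_order_on UNIV ?s"
  proof -
    have "?s - Id = {(False, True)}" by auto
    then have "wf (?s - Id)" by (simp add: wf_insert)
    then show ?thesis
      by (auto simp: order_on_defs refl_on_def total_on_def trans_def antisym_def)
  qed
  have "well_order_on V ?r'"
  proof (rule well_order_on_lex_sum[OF s])
    fix b :: bool
    have "V \<inter> ?\<rho> -` {b} = (if b then V - U else U)" using assms by auto
    then show "well_order_on (V \<inter> ?\<rho> -` {b}) (if b then q else r)" using q assms by simp
  qed simp
  moreover have "r \<subseteq> ?r'"
    using well_order_on_domain[OF assms(1)] assms(2) by (auto simp: lex_sum_def)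
  ultimately show ?thesis by (rule that)
qed

section \<open>Rankings of the vertices and maximizing well-orderings\<close>

text \<open>Both constructions use a good cut through this property: \<open>\<tau> E\<close> is the
  greatest rank of a vertex of \<open>E\<close>, and it is attained.\<close>

definition top_ranked :: "'i rel \<Rightarrow> ('a \<Rightarrow> 'i) \<Rightarrow> ('a set \<Rightarrow> 'i) \<Rightarrow> 'a set set \<Rightarrow> bool" where
  "top_ranked s \<rho> \<tau> A \<longleftrightarrow> Well_order s \<and> \<rho> ` \<Union>A \<subseteq> Field s \<and>
     (\<forall>E\<in>A. \<tau> E \<in> \<rho> ` E \<and> (\<forall>x\<in>E. (\<rho> x, \<tau> E) \<in> s))"

text \<open>The intended \<open>\<E>\<close> consists of edges with top rank \<open>i\<close>. It is
  a parameter because a cover has to deal only with those of these edges that are not yet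
  met.\<close>

definition top_parts :: "('a \<Rightarrow> 'i) \<Rightarrow> 'i \<Rightarrow> 'a set set \<Rightarrow> 'a set set" where
  "top_parts \<rho> i \<E> = (\<lambda>E. E \<inter> \<rho> -` {i}) ` \<E>"

text \<open>Every vertex of an edge outside its top part has smaller rank. In the sum of orders on
  the rank classes, the maximum of the top part is therefore the maximum of the edge.\<close>

lemma maximizing_well_ordering_if_top_parts:
  fixes A :: "'a set set"
  assumes rk: "top_ranked s \<rho> \<tau> A"
    and parts: "\<And>i. \<exists>r. maximizing_well_ordering (top_parts \<rho> i {E \<in> A. \<tau> E = i}) r"
  shows "\<exists>r. maximizing_well_ordering A r"
proof -
  let ?P = "\<lambda>i. top_parts \<rho> i {E \<in> A. \<tau> E = i}"
  have "\<exists>W. well_order_on (\<Union>A \<inter> \<rho> -` {i}) W \<and> (\<forall>E\<in>?P i. \<exists>m\<in>E. \<forall>x\<in>E. (x, m) \<in> W)" for i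
  proof -
    obtain r where r: "well_order_on (\<Union>(?P i)) r" "\<forall>E\<in>?P i. \<exists>m\<in>E. \<forall>x\<in>E. (x, m) \<in> r"
      using parts[of i] by (auto simp: maximizing_well_ordering_def)
    \<comment> \<open>A rank class may contain vertices that lie in no edge with top rank
      \<open>i\<close>, so the given order has to be extended to the whole class.\<close>
    have "\<Union>(?P i) \<subseteq> \<Union>A \<inter> \<rho> -` {i}" by (auto simp: top_parts_def)
    then obtain W where W: "well_order_on (\<Union>A \<inter> \<rho> -` {i}) W" "r \<subseteq> W"
      by (rule well_order_on_extension[OF r(1)])
    have "\<exists>m\<in>E. \<forall>x\<in>E. (x, m) \<in> W" if "E \<in> ?P i" for E
      using bspec[OF r(2) that] subsetD[OF W(2)] by blast
    then show ?thesis using W(1) by blast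
  qed
  then obtain W where W: "\<And>i. well_order_on (\<Union>A \<inter> \<rho> -` {i}) (W i)"
    "\<And>i E. E \<in> ?P i \<Longrightarrow> \<exists>m\<in>E. \<forall>x\<in>E. (x, m) \<in> W i" by metis
  have "\<exists>m\<in>E. \<forall>x\<in>E. (x, m) \<in> lex_sum s \<rho> W (\<Union>A)" if "E \<in> A" for E
  proof -
    have "E \<inter> \<rho> -` {\<tau> E} \<in> ?P (\<tau> E)" using that by (auto simp: top_parts_def)
    then obtain m where m: "m \<in> E" "\<rho> m = \<tau> E" "\<And>x. x \<in> E \<Longrightarrow> \<rho> x = \<tau> E \<Longrightarrow> (x, m) \<in> W (\<tau> E)"
      using W(2)[of _ "\<tau> E"] by blast
    then have "\<forall>x\<in>E. (x, m) \<in> lex_sum s \<rho> W (\<Union>A)"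
      using rk that by (auto simp: lex_sum_def top_ranked_def)
    then show ?thesis using m(1) by blast
  qed
  moreover have "well_order_on (\<Union>A) (lex_sum s \<rho> W (\<Union>A))"
    using well_order_on_lex_sum[of "Field s" s \<rho> "\<Union>A" W] W(1) rk by (auto simp: top_ranked_def)
  ultimately show ?thesis unfolding maximizing_well_ordering_def by blast
qed

section \<open>Minimal vertex covers from top parts\<close>

text \<open>Minimality can be tested by deleting one vertex at a time, and deleting \<open>y\<close>
  destroys a cover exactly if some edge is met in \<open>y\<close> alone. This private-edge form can
  be checked rank by rank.\<close>

lemma minimal_vertex_cover_iff:
  "minimal_vertex_cover A Y \<longleftrightarrow> vertex_cover A Y \<and> (\<forall>y\<in>Y. \<exists>E\<in>A. Y \<inter> E = {y})"
proof (cases "vertex_cover A Y")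
  case cover: True
  have "(\<forall>Z. Z \<subset> Y \<longrightarrow> \<not> vertex_cover A Z) \<longleftrightarrow> (\<forall>y\<in>Y. \<exists>E\<in>A. Y \<inter> E = {y})"
  proof (intro iffI ballI allI impI)
    fix y assume min: "\<forall>Z. Z \<subset> Y \<longrightarrow> \<not> vertex_cover A Z" and "y \<in> Y"
    then have "\<not> vertex_cover A (Y - {y})" by blast
    then obtain E where "E \<in> A" "(Y - {y}) \<inter> E = {}" using cover by (auto simp: vertex_cover_def)
    then show "\<exists>E\<in>A. Y \<inter> E = {y}" using cover by (intro bexI[of _ E]) (auto simp: vertex_cover_def)
  next
    fix Z assume "\<forall>y\<in>Y. \<exists>E\<in>A. Y \<inter> E = {y}" and "Z \<subset> Y"
    moreover then obtain y where "y \<in> Y - Z" by blast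
    ultimately obtain E where "E \<in> A" "Y \<inter> E = {y}" by blast
    then have "Z \<inter> E = {}" using \<open>Z \<subset> Y\<close> \<open>y \<in> Y - Z\<close> by auto
    then show "\<not> vertex_cover A Z" using \<open>E \<in> A\<close> by (auto simp: vertex_cover_def)
  qed
  then show ?thesis using cover by (simp add: minimal_vertex_cover_def)
qed (simp add: minimal_vertex_cover_def)

text \<open>The cover is built by recursion along \<open>s\<close>: stage \<open>i\<close> minimally
  covers the top parts of those edges of top rank \<open>i\<close> that the earlier stages miss. An
  edge private to a vertex at its stage stays private, since earlier stages miss it and later ones
  have ranks above its top.\<close>

lemma minimal_vertex_cover_if_top_parts:
  fixes A :: "'a set set"
  assumes rk: "top_ranked s \<rho> \<tau> A"
    and parts: "\<And>i \<E>. \<E> \<subseteq> {E \<in> A. \<tau> E = i} \<Longrightarrow> \<exists>Y. minimal_vertex_cover (top_parts \<rho> i \<E>) Y"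
  shows "\<exists>Y. minimal_vertex_cover A Y"
proof -
  let ?r = "s - Id"
  let ?new = "\<lambda>Y i. {E \<in> A. \<tau> E = i \<and> (\<Union>j\<in>{j. (j, i) \<in> ?r}. Y j) \<inter> E = {}}"
  have "wf ?r" using rk by (auto simp: top_ranked_def order_on_defs)
  then have "\<exists>Y. \<forall>i. minimal_vertex_cover (top_parts \<rho> i (?new Y i)) (Y i)"
  \<comment> \<open>The condition on stage \<open>i\<close> mentions earlier choices. Well-founded
    choice is possible because it depends on \<open>Y\<close> only below \<open>i\<close>, and
    because a suitable set exists for any \<open>Y\<close>.\<close>
  proof (rule dependent_wf_choice)
    fix Y Y' :: "_ \<Rightarrow> 'a set" and i Z assume "\<And>j. (j, i) \<in> ?r \<Longrightarrow> Y j = Y' j"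
    then have "(\<Union>j\<in>{j. (j, i) \<in> ?r}. Y j) = (\<Union>j\<in>{j. (j, i) \<in> ?r}. Y' j)" by blast
    then show "minimal_vertex_cover (top_parts \<rho> i (?new Y i)) Z =
      minimal_vertex_cover (top_parts \<rho> i (?new Y' i)) Z" by simp
  next
    fix Y :: "_ \<Rightarrow> 'a set" and i
    show "\<exists>Z. minimal_vertex_cover (top_parts \<rho> i (?new Y i)) Z" by (rule parts) blast
  qed
  then obtain Y where Y: "\<And>i. minimal_vertex_cover (top_parts \<rho> i (?new Y i)) (Y i)" by blast
  then have cover: "vertex_cover (top_parts \<rho> i (?new Y i)) (Y i)" for i
    by (simp add: minimal_vertex_cover_iff)
  then have Y_sub: "Y i \<subseteq> \<Union>A \<inter> \<rho> -` {i}" for i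
    by (fastforce simp: vertex_cover_def top_parts_def)
  have "vertex_cover A (\<Union>i. Y i)"
    unfolding vertex_cover_def
  proof (intro conjI ballI)
    show "(\<Union>i. Y i) \<subseteq> \<Union>A" using Y_sub by blast
  next
    fix E assume "E \<in> A"
    show "(\<Union>i. Y i) \<inter> E \<noteq> {}"
    \<comment> \<open>Either the edge is still unmet when its top rank is reached, and that stage
      meets its top part, or an earlier stage has met it.\<close>
    proof (cases "E \<in> ?new Y (\<tau> E)")
      case True
      then have "Y (\<tau> E) \<inter> (E \<inter> \<rho> -` {\<tau> E}) \<noteq> {}"
        using cover[of "\<tau> E"] by (auto simp: vertex_cover_def top_parts_def)
      then show ?thesis by blast
    qed (use \<open>E \<in> A\<close> in blast)
  qed
  moreover have "\<exists>E\<in>A. (\<Union>i. Y i) \<inter> E = {y}" if "y \<in> Y i" for y i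
  proof -
    obtain F where "F \<in> top_parts \<rho> i (?new Y i)" "Y i \<inter> F = {y}"
      using Y[of i] \<open>y \<in> Y i\<close> unfolding minimal_vertex_cover_iff by blast
    moreover then obtain E where E: "E \<in> ?new Y i" "F = E \<inter> \<rho> -` {i}"
      unfolding top_parts_def by (elim imageE)
    ultimately have E_y: "Y i \<inter> (E \<inter> \<rho> -` {i}) = {y}" by simp
    have uniq: "z = y" if "z \<in> Y j" "z \<in> E" for z j
    proof (cases "j = i")
      case True
      then show ?thesis using that E_y Y_sub[of j] by blast
    next
      case False
      \<comment> \<open>Since \<open>z\<close> lies in \<open>E\<close>, its rank \<open>j\<close>
        is below the top rank \<open>i\<close>; so an earlier stage would have met \<open>E\<close>,
        contrary to \<open>E\<close> being new at stage \<open>i\<close>.\<close>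
      have "\<rho> z = j" using that Y_sub by blast
      then have "(j, i) \<in> ?r" using E(1) that False rk by (auto simp: top_ranked_def)
      then show ?thesis using E(1) that by blast
    qed
    have "E \<in> A" "y \<in> E" using E(1) E_y by auto
    moreover have "(\<Union>i. Y i) \<inter> E = {y}"
      using uniq \<open>y \<in> Y i\<close> \<open>y \<in> E\<close> by blast
    ultimately show ?thesis by blast
  qed
  ultimately show ?thesis unfolding minimal_vertex_cover_iff by blast
qed

section \<open>The ranking given by a good cut\<close>

text \<open>The rank of \<open>x\<close> is the least \<open>i\<close> with \<open>x \<in> G\<^sub>i\<^sub>+\<^sub>1\<close>; continuity of the cut makes its rank classes the
  differences \<open>G\<^sub>i\<^sub>+\<^sub>1 - G\<^sub>i\<close>.\<close>

lemma good_cut_top_ranked: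
  fixes A :: "'a set set"
  assumes "good_cut A G"
  obtains s :: "'a rel" and \<rho> \<tau> where "top_ranked s \<rho> \<tau> A"
    "\<And>i. i \<in> Field s \<Longrightarrow> |\<Union>A \<inter> \<rho> -` {i}| <o |\<Union>A|"
    "\<And>E. E \<in> A \<Longrightarrow> |E - \<rho> -` {\<tau> E}| <o |E|"
proof -
  define s where "s = cf |\<Union>A|"
  obtain K where "s = |K|" using cf_least[OF card_of_Well_order] unfolding s_def by blast
  then have wo: "Well_order s" using card_of_Well_order by metis
  then interpret wo: wo_rel s by (simp add: wo_rel_def)
  let ?suc = "\<lambda>i. wo.suc {i}"
  note cut = assms[unfolded good_cut_def Let_def, folded s_def]
  have chain: "G i \<subseteq> G j" if "(i, j) \<in> s" for i j
    using cut[THEN conjunct1] that by (simp add: relChain_def)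
  note cut = cut[THEN conjunct2]
  have limit: "G d = (\<Union>a\<in>underS s d. G a)" if "limit_index s d" for d
    using cut[THEN conjunct1] that by blast
  note cut = cut[THEN conjunct2]
  have sub: "G i \<subseteq> \<Union>A" and small: "|G i| <o |\<Union>A|" if "i \<in> Field s" for i
    using cut[THEN conjunct1] that by simp_all
  note cut = cut[THEN conjunct2]
  have zero: "G i = {}" if "i \<in> Field s" "underS s i = {}" for i
    using cut[THEN conjunct1] that by simp
  note cut = cut[THEN conjunct2]
  have union: "(\<Union>i\<in>Field s. G i) = \<Union>A" by (rule cut[THEN conjunct1])
  note cut = cut[THEN conjunct2]
  have edge: "\<exists>i\<in>Field s. E \<subseteq> G (?suc i) \<and> |G i \<inter> E| <o |E|" if E: "E \<in> A" for E
  proof -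
    obtain i where "i \<in> Field s" "E \<subseteq> G (?suc i)" "|G i \<inter> E| <o |E|"
      using bspec[OF cut E] by (elim bexE conjE)
    then show ?thesis by (intro bexI conjI)
  qed
  \<comment> \<open>With a greatest index \<open>i\<close>, monotonicity would give
    \<open>G i = \<Union>A\<close>, which is too large. Hence \<open>?suc\<close> is a genuine
    successor at every index.\<close>
  have no_top: "aboveS s i \<noteq> {}" if i: "i \<in> Field s" for i
  proof
    assume "aboveS s i = {}"
    then have "(j, i) \<in> s" if "j \<in> Field s" for j
    proof -
      have "(j, i) \<in> s \<or> (i, j) \<in> s" "(i, i) \<in> s" using wo.TOTALS i that by blast+
      then show ?thesis using \<open>aboveS s i = {}\<close> by (cases "j = i") (auto simp: aboveS_def)
    qed
    then have "\<Union>A \<subseteq> G i" using chain union by blast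
    then have "|\<Union>A| \<le>o |G i|" by (rule card_of_mono1)
    then show False using not_ordLess_ordLeq[OF small[OF i]] by contradiction
  qed
  have AboveS: "AboveS s {i} \<noteq> {}" if "i \<in> Field s" for i
    using no_top[OF that] by (auto simp: aboveS_def AboveS_def Field_def)
  have suc_gt: "(i, ?suc i) \<in> s" "?suc i \<noteq> i" "?suc i \<in> Field s" if "i \<in> Field s" for i
    using wo.suc_greater[of "{i}" i] wo.suc_inField[of "{i}"] AboveS[OF that] that by auto
  have suc_le: "(?suc i, j) \<in> s" if "(i, j) \<in> s" "i \<noteq> j" for i j
    using wo.suc_least_AboveS[of j "{i}"] that by (auto simp: AboveS_def Field_def)
  \<comment> \<open>For \<open>x\<close> outside \<open>\<Union>A\<close> the set is empty and the
    value of \<open>minim\<close> carries no information.\<close>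
  define \<rho> where "\<rho> x = wo.minim {i \<in> Field s. x \<in> G (?suc i)}" for x
  have ne: "{i \<in> Field s. x \<in> G (?suc i)} \<noteq> {}" if "x \<in> \<Union>A" for x
    using that union chain[OF suc_gt(1)] by blast
  have \<rho>_in: "\<rho> x \<in> Field s" "x \<in> G (?suc (\<rho> x))" if "x \<in> \<Union>A" for x
    using wo.minim_in[OF _ ne[OF that]] by (auto simp: \<rho>_def)
  have \<rho>_le: "(\<rho> x, i) \<in> s" if "i \<in> Field s" "x \<in> G (?suc i)" for x i
    using wo.minim_least[of "{i \<in> Field s. x \<in> G (?suc i)}" i] that by (auto simp: \<rho>_def)
  have not_in: "x \<notin> G (\<rho> x)" if "x \<in> \<Union>A" for x
  proof
    assume x: "x \<in> G (\<rho> x)"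
    let ?i = "\<rho> x"
    have i: "?i \<in> Field s" using \<rho>_in[OF that] by blast
    \<comment> \<open>If \<open>x\<close> were already in \<open>G ?i\<close>, it would be in
      \<open>G (?suc j)\<close> for some smaller \<open>j\<close>, against the choice of the rank:
      at a limit this is continuity, at a successor \<open>j\<close> is the predecessor, and the
      least index is excluded by \<open>G\<close> being empty there.\<close>
    have "\<exists>j\<in>underS s ?i. x \<in> G (?suc j)"
    proof (cases "limit_index s ?i")
      case True
      then obtain j where j: "j \<in> underS s ?i" "x \<in> G j" using limit x by blast
      then have "j \<in> Field s" by (auto simp: underS_def Field_def)
      then show ?thesis using j chain[OF suc_gt(1)] by blast
    next
      case False
      moreover have "underS s ?i \<noteq> {}" using zero[OF i] x by blast
      ultimately obtain j where j: "j \<in> underS s ?i"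
        and jmax: "\<And>b. b \<in> underS s ?i \<Longrightarrow> (j, b) \<in> s \<Longrightarrow> j = b"
        using i unfolding limit_index_def by blast
      then have "j \<in> Field s" by (auto simp: underS_def Field_def)
      \<comment> \<open>If \<open>?suc j\<close> were strictly below \<open>?i\<close>, maximality
        of \<open>j\<close> would force \<open>?suc j = j\<close>.\<close>
      moreover have "(?suc j, ?i) \<in> s" using j suc_le by (auto simp: underS_def)
      ultimately have "?suc j = ?i" using jmax[of "?suc j"] suc_gt[of j] by (auto simp: underS_def)
      then show ?thesis using j x by (intro bexI[of _ j]) simp_all
    qed
    then obtain j where j: "(j, ?i) \<in> s" "j \<noteq> ?i" "x \<in> G (?suc j)" by (auto simp: underS_def)
    then have "(?i, j) \<in> s" using \<rho>_le by (auto simp: Field_def)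
    then show False using j wo.ANTISYM by (auto dest: antisymD)
  qed
  have \<rho>_eq: "\<rho> x = i" if "i \<in> Field s" "x \<in> G (?suc i)" "x \<notin> G i" for x i
  proof (rule ccontr)
    \<comment> \<open>A rank strictly below \<open>i\<close> has its successor at or below
      \<open>i\<close>, so \<open>x\<close> would already lie in \<open>G i\<close>.\<close>
    assume "\<rho> x \<noteq> i"
    moreover have "(\<rho> x, i) \<in> s" using \<rho>_le that by blast
    ultimately have "G (?suc (\<rho> x)) \<subseteq> G i" using suc_le chain by blast
    moreover have "x \<in> \<Union>A" using that sub suc_gt(3) by blast
    ultimately show False using \<rho>_in(2) that(3) by blast
  qed
  obtain \<tau> where \<tau>: "\<And>E. E \<in> A \<Longrightarrow> \<tau> E \<in> Field s \<and> E \<subseteq> G (?suc (\<tau> E)) \<and> |G (\<tau> E) \<inter> E| <o |E|"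
    using edge by metis
  have "top_ranked s \<rho> \<tau> A"
    unfolding top_ranked_def
  proof (intro conjI ballI)
    fix E assume "E \<in> A"
    note \<tau>E = \<tau>[OF this]
    \<comment> \<open>The strict inequality of cardinals leaves a vertex of \<open>E\<close> outside
      \<open>G (\<tau> E)\<close>. It has rank \<open>\<tau> E\<close>, so the top rank is
      attained.\<close>
    have "\<not> E \<subseteq> G (\<tau> E)"
    proof
      assume "E \<subseteq> G (\<tau> E)"
      then have "G (\<tau> E) \<inter> E = E" by blast
      then show False using \<tau>E by (metis ordLess_irreflexive)
    qed
    then obtain x where "x \<in> E" "x \<notin> G (\<tau> E)" by blast
    then have "\<rho> x = \<tau> E" using \<rho>_eq[of "\<tau> E" x] \<tau>E by blast
    then show "\<tau> E \<in> \<rho> ` E" using \<open>x \<in> E\<close> by (metis imageI)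
    show "(\<rho> x, \<tau> E) \<in> s" if "x \<in> E" for x using \<rho>_le[of "\<tau> E" x] \<tau>E that by blast
  qed (use wo \<rho>_in in auto)
  moreover have "|\<Union>A \<inter> \<rho> -` {i}| <o |\<Union>A|" if "i \<in> Field s" for i
  proof -
    have "\<Union>A \<inter> \<rho> -` {i} \<subseteq> G (?suc i)" using \<rho>_in(2) by blast
    then show ?thesis by (rule ordLeq_ordLess_trans[OF card_of_mono1 small[OF suc_gt(3)[OF that]]])
  qed
  moreover have "|E - \<rho> -` {\<tau> E}| <o |E|" if E: "E \<in> A" for E
  proof -
    \<comment> \<open>The vertices of \<open>E\<close> below the top rank lie in
      \<open>G (\<tau> E)\<close>, which contains fewer than \<open>|E|\<close> vertices of
      \<open>E\<close>.\<close>
    have "x \<in> G (\<tau> E)" if "x \<in> E" "\<rho> x \<noteq> \<tau> E" for x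
      using \<rho>_eq[of "\<tau> E" x] \<tau>[OF E] that by blast
    then have "E - \<rho> -` {\<tau> E} \<subseteq> G (\<tau> E) \<inter> E" by auto
    then show ?thesis using \<tau>[OF E] by (blast intro: ordLeq_ordLess_trans[OF card_of_mono1])
  qed
  ultimately show ?thesis by (rule that)
qed

section \<open>Induction on the number of vertices and its two applications\<close>

text \<open>Above \<open>\<kappa>\<close> a good cut provides a ranking. The top parts of a fixed
  rank form a shrink, hence a member of \<open>\<AA>\<close>, and their vertices lie in one rank
  class, which has fewer elements than \<open>\<Union>A\<close>. The property \<open>P\<close> is
  left abstract to serve both assertions.\<close>

lemma good_cut_induct:
  fixes \<AA> :: "'a set set set"
  assumes card: "Card_order \<kappa>"
    and hyp: "\<And>A. A \<in> \<AA> \<Longrightarrow> hypergraph A"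
    and shrink: "\<And>A B. A \<in> \<AA> \<Longrightarrow> hypergraph B \<Longrightarrow> B \<lless> A \<Longrightarrow> B \<in> \<AA>"
    and cut: "\<And>A. A \<in> \<AA> \<Longrightarrow> \<kappa> <o |\<Union>A| \<Longrightarrow> \<exists>G. good_cut A G"
    and small: "\<And>A. A \<in> \<AA> \<Longrightarrow> |\<Union>A| \<le>o \<kappa> \<Longrightarrow> P A"
    and step: "\<And>A (s :: 'a rel) \<rho> \<tau>. top_ranked s \<rho> \<tau> A \<Longrightarrow>
      (\<And>i \<E>. \<E> \<subseteq> {E \<in> A. \<tau> E = i} \<Longrightarrow> P (top_parts \<rho> i \<E>)) \<Longrightarrow> P A"
    and "A \<in> \<AA>"
  shows "P A"
proof -
  \<comment> \<open>The cardinal \<open>|\<Union>A|\<close> is itself a relation on the vertex type,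
    so the induction runs over such relations along \<open><o\<close>.\<close>
  have "\<forall>A\<in>\<AA>. |\<Union>A| = c \<longrightarrow> P A" for c :: "'a rel"
  proof (induction c rule: wf_induct[OF wf_ordLess])
    case (1 c)
    have "P A" if A: "A \<in> \<AA>" "|\<Union>A| = c" for A
    proof (cases "\<kappa> <o |\<Union>A|")
      case True
      then obtain G where "good_cut A G" using cut A(1) by blast
      then obtain s :: "'a rel" and \<rho> \<tau> where rk: "top_ranked s \<rho> \<tau> A"
        and lt: "\<And>i. i \<in> Field s \<Longrightarrow> |\<Union>A \<inter> \<rho> -` {i}| <o |\<Union>A|"
        and sh: "\<And>E. E \<in> A \<Longrightarrow> |E - \<rho> -` {\<tau> E}| <o |E|"
        by (rule good_cut_top_ranked) blast
      show ?thesis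
      proof (rule step[OF rk])
        fix i \<E> assume \<E>: "\<E> \<subseteq> {E \<in> A. \<tau> E = i}"
        let ?B = "top_parts \<rho> i \<E>"
        have "hypergraph ?B"
          unfolding hypergraph_def top_parts_def
        proof
          assume "{} \<in> (\<lambda>E. E \<inter> \<rho> -` {i}) ` \<E>"
          then obtain E where "E \<in> \<E>" "E \<inter> \<rho> -` {i} = {}" by auto
          \<comment> \<open>Because top ranks are attained, no top part is empty.\<close>
          moreover then have "i \<in> \<rho> ` E" using \<E> rk by (auto simp: top_ranked_def)
          ultimately show False by auto
        qed
        moreover have "?B \<lless> A"
          unfolding shrink_def
        proof
          fix F assume "F \<in> ?B"
          then obtain E where E: "E \<in> A" "\<tau> E = i" "F = E \<inter> \<rho> -` {i}"
            using \<E> by (auto simp: top_parts_def)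
          then have "E - F = E - \<rho> -` {\<tau> E}" by blast
          then have "|E - F| <o |E|" using sh[OF E(1)] by simp
          then show "\<exists>E\<in>A. F \<subseteq> E \<and> |E - F| <o |E|" using E by blast
        qed
        ultimately have "?B \<in> \<AA>" using shrink A(1) by blast
        moreover have "|\<Union>?B| <o |\<Union>A|"
        proof (cases "i \<in> Field s")
          case True
          have "\<Union>?B \<subseteq> \<Union>A \<inter> \<rho> -` {i}" using \<E> by (auto simp: top_parts_def)
          then show ?thesis using lt[OF True] card_of_mono1 ordLeq_ordLess_trans by blast
        next
          case False
          \<comment> \<open>An index outside \<open>Field s\<close> is no top rank, so there are no
            edges to treat; it remains that \<open>\<Union>A\<close> is non-empty, which follows
            from its being larger than \<open>\<kappa>\<close>.\<close>
          have "i \<in> Field s" if "E \<in> \<E>" for E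
          proof -
            have "E \<in> A" "i \<in> \<rho> ` E" using \<E> rk that by (auto simp: top_ranked_def)
            then show ?thesis using rk by (auto simp: top_ranked_def)
          qed
          then have "\<E> = {}" using False by blast
          moreover have "|{} :: 'a set| <o |\<Union>A|"
            using card_of_empty1 card \<open>\<kappa> <o |\<Union>A|\<close> ordLeq_ordLess_trans by blast
          ultimately show ?thesis by (simp add: top_parts_def)
        qed
        ultimately show "P ?B" using 1 A(2) by blast
      qed
    next
      case False
      then have "|\<Union>A| \<le>o \<kappa>"
        using card card_of_Well_order not_ordLess_iff_ordLeq by (metis card_order_on_well_order_on)
      then show ?thesis using small A(1) by blast
    qed
    then show ?case by blast
  qed
  then show ?thesis using \<open>A \<in> \<AA>\<close> by blast
qed

theorem theorem2p5:
  fixes \<kappa> :: "'k rel" and \<AA> :: "'a set set set"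
  assumes "Card_order \<kappa>" and "cinfinite \<kappa>"
    and "\<forall>A\<in>\<AA>. hypergraph A"
    and "\<forall>A\<in>\<AA>. \<forall>B. hypergraph B \<and> B \<lless> A \<longrightarrow> B \<in> \<AA>"
    and "\<forall>A\<in>\<AA>. \<kappa> <o |\<Union>A| \<longrightarrow> (\<exists>G. good_cut A G)"
  shows "((\<forall>A\<in>\<AA>. |\<Union>A| \<le>o \<kappa> \<longrightarrow> (\<exists>Y. minimal_vertex_cover A Y)) \<longrightarrow>
            (\<forall>A\<in>\<AA>. \<exists>Y. minimal_vertex_cover A Y)) \<and>
         ((\<forall>A\<in>\<AA>. |\<Union>A| \<le>o \<kappa> \<longrightarrow> (\<exists>r. maximizing_well_ordering A r)) \<longrightarrow>
            (\<forall>A\<in>\<AA>. \<exists>r. maximizing_well_ordering A r))"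
proof (intro conjI impI ballI)
  fix A assume *: "\<forall>A\<in>\<AA>. |\<Union>A| \<le>o \<kappa> \<longrightarrow> (\<exists>Y. minimal_vertex_cover A Y)" and A: "A \<in> \<AA>"
  show "\<exists>Y. minimal_vertex_cover A Y"
  proof (rule good_cut_induct[of \<kappa> \<AA>])
    show "\<exists>Y. minimal_vertex_cover A Y"
      if "top_ranked s \<rho> \<tau> A"
        and "\<And>i \<E>. \<E> \<subseteq> {E \<in> A. \<tau> E = i} \<Longrightarrow> \<exists>Y. minimal_vertex_cover (top_parts \<rho> i \<E>) Y"
      for A :: "'a set set" and s :: "'a rel" and \<rho> \<tau>
      using that by (rule minimal_vertex_cover_if_top_parts)
  qed (use assms * A in blast)+
next
  fix A assume *: "\<forall>A\<in>\<AA>. |\<Union>A| \<le>o \<kappa> \<longrightarrow> (\<exists>r. maximizing_well_ordering A r)" and A: "A \<in> \<AA>"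
  show "\<exists>r. maximizing_well_ordering A r"
  proof (rule good_cut_induct[of \<kappa> \<AA>])
    show "\<exists>r. maximizing_well_ordering A r"
      if "top_ranked s \<rho> \<tau> A"
        and "\<And>i \<E>. \<E> \<subseteq> {E \<in> A. \<tau> E = i} \<Longrightarrow> \<exists>r. maximizing_well_ordering (top_parts \<rho> i \<E>) r"
      for A :: "'a set set" and s :: "'a rel" and \<rho> \<tau>
      \<comment> \<open>The induction hypothesis is applied to the full family of edges with top
        rank \<open>i\<close>.\<close>
      by (rule maximizing_well_ordering_if_top_parts[OF that(1)]) (rule that(2), blast)
  qed (use assms * A in blast)+
qed

end
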